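(* Let $L$ be a finite-dimensional Leibniz algebra over $\mathbb{C}$ and let $A$ be an automorphism of $L$. Then there exist a unique diagonalizable automorphism $A_0$ of $L$ and a unique nilpotent derivation $T$ of $L$ such that $A = A_0\exp(T)$ and $A_0 T = T A_0$.
   Context: A (right) Leibniz algebra over a field $F$ is an $F$-vector space $L$ with a bilinear multiplication $[-,-]$ satisfying $[[x,y],z]=[[x,z],y]+[x,[y,z]]$ for all $x,y,z\in L$. A derivation of $L$ is a linear map $d\colon L\to L$ with $d([x,y])=[d(x),y]+[x,d(y)]$ for all $x,y\in L$. An automorphism of $L$ is a bijective linear map $A\colon L\to L$ with $A([x,y])=[A(x),A(y)]$ for all $x,y\in L$. Diagonalizable and nilpotent are meant as properties of linear operators on $L$, and $\exp(T)=\sum_{k\ge 0}T^k/k!$. Uniqueness refers to the pair $(A_0,T)$ with the stated properties. *)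

theory Defs
  imports Complex_Main
begin

text \<open>Vector spaces are given by a type together with an explicit scalar multiplication
  \<open>scale\<close>, so that finite-dimensional spaces over \<open>complex\<close> are instances of the library locale
  \<open>finite_dimensional_vector_space\<close>. The zero space is included.\<close>

locale leibniz_algebra = vector_space scale
  for scale :: "'f::field \<Rightarrow> 'a::ab_group_add \<Rightarrow> 'a" +
  fixes bracket :: "'a \<Rightarrow> 'a \<Rightarrow> 'a"
  assumes linear_bracket_left: "Vector_Spaces.linear scale scale (\<lambda>x. bracket x y)"
    and linear_bracket_right: "Vector_Spaces.linear scale scale (\<lambda>y. bracket x y)"
    and right_leibniz:
      "bracket (bracket x y) z = bracket (bracket x z) y + bracket x (bracket y z)"

definition leibniz_derivation ::
    "('f::field \<Rightarrow> 'a::ab_group_add \<Rightarrow> 'a) \<Rightarrow> ('a \<Rightarrow> 'a \<Rightarrow> 'a) \<Rightarrow> ('a \<Rightarrow> 'a) \<Rightarrow> bool" where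
  "leibniz_derivation scale bracket d \<longleftrightarrow>
     Vector_Spaces.linear scale scale d \<and>
     (\<forall>x y. d (bracket x y) = bracket (d x) y + bracket x (d y))"

definition leibniz_automorphism ::
    "('f::field \<Rightarrow> 'a::ab_group_add \<Rightarrow> 'a) \<Rightarrow> ('a \<Rightarrow> 'a \<Rightarrow> 'a) \<Rightarrow> ('a \<Rightarrow> 'a) \<Rightarrow> bool" where
  "leibniz_automorphism scale bracket A \<longleftrightarrow>
     Vector_Spaces.linear scale scale A \<and> bij A \<and>
     (\<forall>x y. A (bracket x y) = bracket (A x) (A y))"

definition diagonalizable_op ::
    "('f::field \<Rightarrow> 'a::ab_group_add \<Rightarrow> 'a) \<Rightarrow> ('a \<Rightarrow> 'a) \<Rightarrow> bool" where
  "diagonalizable_op scale f \<longleftrightarrow>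
     Vector_Spaces.linear scale scale f \<and>
     (\<exists>B. \<not> module.dependent scale B \<and> module.span scale B = UNIV \<and>
          (\<forall>b\<in>B. \<exists>c. f b = scale c b))"

definition nilpotent_op ::
    "('f::field \<Rightarrow> 'a::ab_group_add \<Rightarrow> 'a) \<Rightarrow> ('a \<Rightarrow> 'a) \<Rightarrow> bool" where
  "nilpotent_op scale f \<longleftrightarrow>
     Vector_Spaces.linear scale scale f \<and> (\<exists>n. \<forall>x. (f ^^ n) x = 0)"

text \<open>The exponential series, summed over its nonzero terms. It is meant for (locally) nilpotent
  operators, where these are finitely many, so that no topology is needed; if infinitely many terms
  are nonzero at \<open>x\<close>, the value at \<open>x\<close> is the meaningless default \<open>0\<close>.\<close>

definition exp_op ::
    "('f::field_char_0 \<Rightarrow> 'a::ab_group_add \<Rightarrow> 'a) \<Rightarrow> ('a \<Rightarrow> 'a) \<Rightarrow> 'a \<Rightarrow> 'a" where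
  "exp_op scale T x = (\<Sum>k | (T ^^ k) x \<noteq> 0. scale (1 / fact k) ((T ^^ k) x))"

lemma exp_op_eq_sum_lessThan:
  assumes vs: "vector_space scale" and T: "Vector_Spaces.linear scale scale T"
    and n: "\<And>x. (T ^^ n) x = 0"
  shows "exp_op scale T x = (\<Sum>k<n. scale (1 / fact k) ((T ^^ k) x))"
proof -
  interpret vector_space scale by (rule vs)
  interpret T: Vector_Spaces.linear scale scale T by (rule T)
  have zero: "(T ^^ j) 0 = 0" for j
    by (induction j) (auto simp: T.zero)
  have "(T ^^ k) x = 0" if "n \<le> k" for k
  proof -
    have "(T ^^ k) x = (T ^^ (k - n)) ((T ^^ n) x)"
      using that by (metis comp_apply funpow_add le_add_diff_inverse2)
    then show ?thesis by (simp add: n zero)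
  qed
  then have "{k. (T ^^ k) x \<noteq> 0} \<subseteq> {..<n}"
    by (auto simp: not_less[symmetric])
  then show ?thesis
    unfolding exp_op_def by (intro sum.mono_neutral_left) auto
qed

end

theory Submission
  imports Defs "HOL-Computational_Algebra.Fundamental_Theorem_Algebra"
    "HOL-Computational_Algebra.Formal_Power_Series"
begin

text \<open>Let \<open>S\<close> act as the scalar \<open>c\<close> on the generalized eigenspace \<open>V\<^sub>c\<close> of \<open>A\<close>. Since the bracket maps
  \<open>V\<^sub>c \<times> V\<^sub>d\<close> into \<open>V\<^sub>c\<^sub>d\<close>, the operator \<open>S\<close> is an automorphism, so \<open>U = S\<^sup>-\<^sup>1 A\<close> is a unipotent
  automorphism and \<open>T = ln U\<close> is nilpotent. Each power \<open>U\<^sup>m = exp (m T)\<close> respects the bracket; both sides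
  of that identity are polynomial in \<open>m\<close>, and comparing the coefficients of \<open>m\<close> shows that \<open>T\<close> is a
  derivation. For uniqueness, an eigenvector of a diagonalizable factor to \<open>c\<close> lies in \<open>V\<^sub>c\<close>, so that
  factor is \<open>S\<close>, and \<open>T\<close> is recovered from \<open>exp T\<close> by the logarithm series.\<close>

subsection \<open>Generalized eigenspaces\<close>

locale vector_space_endo = vector_space scale
  for scale :: "'f::field \<Rightarrow> 'a::ab_group_add \<Rightarrow> 'a"  (infixr \<open>*s\<close> 75)
begin

sublocale endo: vector_space_pair scale scale
  by unfold_locales

abbreviation "endo \<equiv> Vector_Spaces.linear scale scale"

lemma endo_funpow:
  assumes "endo A"
  shows "endo (A ^^ n)"
proof (induction n)
  case 0
  show ?case by (simp add: Vector_Spaces.linear_iff vector_space_axioms)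
next
  case (Suc n)
  show ?case
    unfolding funpow.simps using Suc assms by (rule Vector_Spaces.linear_compose)
qed

lemma endo_eq_on:
  assumes "endo f" "endo g" "span S = UNIV" "\<And>x. x \<in> S \<Longrightarrow> f x = g x"
  shows "f = g"
  using endo.linear_eq_on[OF assms(1,2), of _ S] assms(3,4) by blast

section \<open>Polynomials in an operator\<close>

definition poly_op :: "('a \<Rightarrow> 'a) \<Rightarrow> 'f poly \<Rightarrow> 'a \<Rightarrow> 'a" where
  "poly_op A p x = (\<Sum>i\<le>degree p. coeff p i *s (A ^^ i) x)"

lemma poly_op_eq:
  assumes "degree p \<le> n"
  shows "poly_op A p x = (\<Sum>i\<le>n. coeff p i *s (A ^^ i) x)"
  unfolding poly_op_def using assms
  by (intro sum.mono_neutral_left) (auto simp: coeff_eq_0)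

lemma poly_op_add: "poly_op A (p + q) x = poly_op A p x + poly_op A q x"
  using poly_op_eq[of p "max (degree p) (degree q)" A x]
    poly_op_eq[of q "max (degree p) (degree q)" A x]
    poly_op_eq[of "p + q" "max (degree p) (degree q)" A x]
  by (simp add: degree_add_le_max sum.distrib scale_left_distrib)

lemma poly_op_smult: "poly_op A (smult c p) x = c *s poly_op A p x"
  by (simp add: poly_op_eq[of "smult c p" "degree p"] poly_op_eq[of p "degree p"]
      scale_sum_right)

lemma poly_op_pCons: "poly_op A (pCons a p) x = a *s x + poly_op A p (A x)"
  by (simp add: poly_op_eq[of "pCons a p" "Suc (degree p)"] poly_op_eq[of p "degree p"]
      degree_pCons_le sum.atMost_Suc_shift funpow_swap1 del: sum.atMost_Suc)

lemma poly_op_diff: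
  assumes "endo A"
  shows "poly_op A p (x - y) = poly_op A p x - poly_op A p y"
  unfolding poly_op_def
  by (simp add: endo.linear_diff[OF endo_funpow[OF assms]] scale_right_diff_distrib sum_subtractf)

lemma poly_op_scale:
  assumes "endo A"
  shows "poly_op A p (c *s x) = c *s poly_op A p x"
  unfolding poly_op_def
  by (simp add: endo.linear_scale[OF endo_funpow[OF assms]] scale_sum_right mult.commute)

text \<open>Splitting off a root \<open>c\<close> turns an annihilator of \<open>x\<close> into an
  annihilator of \<open>A x - c *s x\<close> of smaller degree.\<close>

lemma poly_op_linear_factor:
  assumes "endo A"
  shows "poly_op A ([:- c, 1:] * p) x = poly_op A p (A x - c *s x)"
proof -
  have "[:- c, 1:] * p = pCons 0 p + smult (- c) p" by simp
  then show ?thesis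
    by (simp only: poly_op_add poly_op_smult poly_op_pCons poly_op_diff poly_op_scale assms) simp
qed

text \<open>The exponent may depend on \<open>x\<close>, so no uniform bound is built in. If
  \<open>c\<close> is not an eigenvalue, the set contains only zero.\<close>

definition gen_eigenspace :: "('a \<Rightarrow> 'a) \<Rightarrow> 'f \<Rightarrow> 'a set" where
  "gen_eigenspace A c = {x. \<exists>n. ((\<lambda>y. A y - c *s y) ^^ n) x = 0}"

lemma endo_shift: "endo A \<Longrightarrow> endo (\<lambda>x. A x - c *s x)"
  by (simp add: Vector_Spaces.linear_iff algebra_simps scale_right_diff_distrib)

lemma funpow_eq_0_mono:
  assumes "endo A" "(A ^^ m) x = 0" "m \<le> n"
  shows "(A ^^ n) x = 0"
proof -
  have "(A ^^ n) x = (A ^^ (n - m)) ((A ^^ m) x)"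
    using assms(3) by (metis comp_apply funpow_add le_add_diff_inverse2)
  then show ?thesis
    by (simp add: assms(2) endo.linear_0[OF endo_funpow[OF assms(1)]])
qed

lemma subspace_funpow_kernel: "endo A \<Longrightarrow> subspace {x. \<exists>n. (A ^^ n) x = 0}"
proof (rule subspaceI)
  fix x y
  assume A: "endo A" and "x \<in> {x. \<exists>n. (A ^^ n) x = 0}" "y \<in> {x. \<exists>n. (A ^^ n) x = 0}"
  then obtain m n where "(A ^^ m) x = 0" "(A ^^ n) y = 0" by blast
  then have "(A ^^ max m n) (x + y) = 0"
    by (simp add: endo.linear_add[OF endo_funpow[OF A]] funpow_eq_0_mono[OF A])
  then show "x + y \<in> {x. \<exists>n. (A ^^ n) x = 0}" by blast
next
  assume A: "endo A"
  then show "0 \<in> {x. \<exists>n. (A ^^ n) x = 0}"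
    using endo.linear_0[OF endo_funpow[OF A]] by blast
next
  fix c x
  assume A: "endo A" and "x \<in> {x. \<exists>n. (A ^^ n) x = 0}"
  then obtain m where "(A ^^ m) x = 0" by blast
  then have "(A ^^ m) (c *s x) = 0"
    by (simp add: endo.linear_scale[OF endo_funpow[OF A]])
  then show "c *s x \<in> {x. \<exists>n. (A ^^ n) x = 0}" by blast
qed

lemma subspace_gen_eigenspace: "endo A \<Longrightarrow> subspace (gen_eigenspace A c)"
  unfolding gen_eigenspace_def by (intro subspace_funpow_kernel endo_shift)

lemma gen_eigenspace_shiftD:
  assumes "A x - c *s x \<in> gen_eigenspace A c"
  shows "x \<in> gen_eigenspace A c"
proof -
  obtain n where "((\<lambda>y. A y - c *s y) ^^ n) (A x - c *s x) = 0"
    using assms unfolding gen_eigenspace_def by blast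
  then have "((\<lambda>y. A y - c *s y) ^^ Suc n) x = 0"
    by (simp add: funpow_Suc_right del: funpow.simps)
  then show ?thesis unfolding gen_eigenspace_def by blast
qed

text \<open>Induction on the number of applications of \<open>A - c\<close> that kill
  \<open>x\<close>; it replaces binomial expansions of powers of \<open>A - c\<close>.\<close>

lemma gen_eigenspace_induct [consumes 2, case_names zero step]:
  assumes "endo A" and "x \<in> gen_eigenspace A c"
    and zero: "P 0"
    and step: "\<And>x. x \<in> gen_eigenspace A c \<Longrightarrow> P (A x - c *s x) \<Longrightarrow> P x"
  shows "P x"
proof -
  obtain n where "((\<lambda>y. A y - c *s y) ^^ n) x = 0"
    using assms(2) unfolding gen_eigenspace_def by blast
  then show ?thesis
  proof (induction n arbitrary: x)
    case 0
    then show ?case using zero by simp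
  next
    case (Suc n)
    have "x \<in> gen_eigenspace A c" using Suc.prems unfolding gen_eigenspace_def by blast
    moreover have "P (A x - c *s x)"
      using Suc.prems by (intro Suc.IH) (simp add: funpow_Suc_right del: funpow.simps)
    ultimately show ?case by (rule step)
  qed
qed

lemma gen_eigenspace_image:
  assumes A: "endo A" and "x \<in> gen_eigenspace A c"
  shows "A x \<in> gen_eigenspace A c"
  using assms
proof (induction rule: gen_eigenspace_induct)
  case zero
  show ?case using A endo.linear_0 subspace_0[OF subspace_gen_eigenspace[OF A]] by metis
next
  case (step x)
  have "A (A x - c *s x) = A (A x) - c *s A x"
    using A by (simp add: endo.linear_diff endo.linear_scale)
  then show ?case using step gen_eigenspace_shiftD by metis
qed

lemma gen_eigenspace_shift_image:
  assumes A: "endo A" and "x \<in> gen_eigenspace A c"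
  shows "A x - d *s x \<in> gen_eigenspace A c"
  using assms gen_eigenspace_image subspace_gen_eigenspace subspace_diff subspace_scale by metis

text \<open>On \<open>V\<^sub>c\<close> the operator \<open>A - d\<close> is the nonzero scalar
  \<open>c - d\<close> plus the locally nilpotent \<open>A - c\<close>, so a preimage of
  \<open>(A - c) x\<close> yields one of \<open>x\<close>.\<close>

lemma gen_eigenspace_shift_surj:
  assumes A: "endo A" and "x \<in> gen_eigenspace A c" and "c \<noteq> d"
  shows "\<exists>z \<in> gen_eigenspace A c. A z - d *s z = x"
  using assms(1,2)
proof (induction rule: gen_eigenspace_induct)
  case zero
  show ?case using endo.linear_0[OF A] subspace_0[OF subspace_gen_eigenspace[OF A]] by force
next
  case (step x)
  then obtain z where z: "z \<in> gen_eigenspace A c" "A z - d *s z = A x - c *s x" by blast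
  \<comment> \<open>From \<open>(A - d) z = (A - c) x\<close> follows
    \<open>(A - d) (x - z) = (c - d) x\<close>.\<close>
  let ?w = "inverse (c - d) *s (x - z)"
  have "A ?w - d *s ?w = inverse (c - d) *s ((A x - d *s x) - (A z - d *s z))"
    using A by (simp add: endo.linear_diff endo.linear_scale algebra_simps)
  also have "(A x - d *s x) - (A z - d *s z) = (c - d) *s x"
    unfolding z(2) by (simp add: algebra_simps)
  finally have "A ?w - d *s ?w = x" using assms(3) by simp
  moreover have "?w \<in> gen_eigenspace A c"
    using z(1) step(1) subspace_gen_eigenspace[OF A] by (simp add: subspace_diff subspace_scale)
  ultimately show ?case by blast
qed

text \<open>On the kernel of \<open>A - d\<close> the operator \<open>A - c\<close> is the nonzero
  scalar \<open>d - c\<close>, so none of its powers kills a nonzero vector there.\<close>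

lemma gen_eigenspace_shift_inj:
  assumes A: "endo A" and "x \<in> gen_eigenspace A c" and "c \<noteq> d" and "A x - d *s x = 0"
  shows "x = 0"
proof -
  from assms(1,2) have "A x - d *s x = 0 \<longrightarrow> x = 0"
  proof (induction rule: gen_eigenspace_induct)
    case zero
    show ?case by simp
  next
    case (step x)
    show ?case
    proof
      assume *: "A x - d *s x = 0"
      then have x: "A x = d *s x" by simp
      have "A (A x - c *s x) - d *s (A x - c *s x) = 0"
        using A x by (simp add: endo.linear_diff endo.linear_scale algebra_simps)
      with step have "A x - c *s x = 0" by blast
      with x have "(d - c) *s x = 0" by (simp add: scale_left_diff_distrib)
      then show "x = 0" using assms(3) by (metis right_minus_eq scale_eq_0_iff)
    qed
  qed
  with assms(4) show ?thesis by blast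
qed

text \<open>A power of \<open>A - d\<close> that kills \<open>v d\<close> leaves a shorter vanishing
  sum. Its terms vanish by induction, and \<open>A - d\<close> is injective on
  \<open>V\<^sub>c\<close> for \<open>c \<noteq> d\<close>.\<close>

lemma gen_eigenspace_independent:
  assumes A: "endo A" and "finite F"
    and "\<And>c. c \<in> F \<Longrightarrow> v c \<in> gen_eigenspace A c" and "sum v F = 0" and "c \<in> F"
  shows "v c = 0"
  using assms(2-)
proof (induction F arbitrary: v c rule: finite_induct)
  case empty
  then show ?case by simp
next
  case (insert d F)
  have rest: "v c = 0" if c: "c \<in> F" for c
  proof -
    obtain n where n: "((\<lambda>y. A y - d *s y) ^^ n) (v d) = 0"
      using insert.prems(1)[of d] unfolding gen_eigenspace_def by blast
    define f where "f = (\<lambda>y. A y - d *s y) ^^ n"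
    have f: "endo f" unfolding f_def by (intro endo_funpow endo_shift A)
    have f_mem: "(g ^^ k) x \<in> gen_eigenspace A e"
      if "x \<in> gen_eigenspace A e" "g = (\<lambda>y. A y - d *s y)" for x e g k
      using that by (induction k) (auto intro: gen_eigenspace_shift_image[OF A])
    have "f (sum v (insert d F)) = f 0" using insert.prems(2) by simp
    then have "(\<Sum>c\<in>F. f (v c)) = 0"
      using insert.hyps n f by (simp add: endo.linear_sum endo.linear_add endo.linear_0 f_def)
    then have "f (v c) = 0"
      using insert.IH[of "\<lambda>c. f (v c)"] insert.prems(1) c f_mem unfolding f_def by blast
    moreover have "v c \<in> gen_eigenspace A c" "c \<noteq> d" using c insert by auto
    ultimately show "v c = 0"
      unfolding f_def
    proof (induction n arbitrary: c)
      case (Suc n)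
      have "A (((\<lambda>y. A y - d *s y) ^^ n) (v c)) - d *s (((\<lambda>y. A y - d *s y) ^^ n) (v c)) = 0"
        using Suc.prems(1) by simp
      from gen_eigenspace_shift_inj[OF A f_mem[OF Suc.prems(2) refl] Suc.prems(3) this]
      show ?case using Suc by blast
    qed simp
  qed
  then have "sum v F = 0" by simp
  with insert have "v d = 0" by simp
  with rest insert.prems(3) show ?case by blast
qed

text \<open>Split off one root \<open>d\<close> of \<open>p\<close> at a time: \<open>A - d\<close> is surjective on every other generalized
  eigenspace, so \<open>x\<close> can be corrected to an element of the one for \<open>d\<close>.\<close>

lemma in_span_gen_eigenspaces:
  assumes A: "endo A"
    and fta: "\<And>p :: 'f poly. degree p > 0 \<Longrightarrow> \<exists>z. poly p z = 0"
    and "p \<noteq> 0" "poly_op A p x = 0"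
  shows "x \<in> span (\<Union>c. gen_eigenspace A c)"
  using assms(3,4)
proof (induction "degree p" arbitrary: p x)
  case 0
  then obtain a where "p = [:a:]" "a \<noteq> 0" by (metis degree_eq_zeroE pCons_0_0)
  with 0 have "x = 0" by (simp add: poly_op_def)
  then show ?case by (simp add: span_zero)
next
  case (Suc n)
  let ?W = "span (\<Union>c. gen_eigenspace A c)"
  obtain d where "poly p d = 0" using fta[of p] Suc.hyps(2) by auto
  then obtain q where q: "p = [:- d, 1:] * q" by (meson dvdE poly_eq_0_iff_dvd)
  have "q \<noteq> 0" using q Suc.prems by auto
  then have "degree q = n"
    using Suc.hyps(2) q degree_mult_eq[of "[:- d, 1:]" q] by auto
  moreover have "poly_op A q (A x - d *s x) = 0"
    using Suc.prems(2) A by (simp only: q poly_op_linear_factor)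
  ultimately have "A x - d *s x \<in> ?W"
    using Suc.hyps(1) \<open>q \<noteq> 0\<close> by blast
  \<comment> \<open>Modulo \<open>V\<^sub>d\<close>, every element of \<open>?W\<close> is an image
    under \<open>A - d\<close>: components in the other \<open>V\<^sub>c\<close> have preimages,
    those in \<open>V\<^sub>d\<close> are discarded.\<close>
  moreover have "\<exists>z \<in> ?W. y - (A z - d *s z) \<in> gen_eigenspace A d" if "y \<in> ?W" for y
    using that
  proof (induction rule: span_induct_alt)
    case base
    show ?case
      using endo.linear_0[OF A] subspace_0[OF subspace_gen_eigenspace[OF A]] span_zero
      by (intro bexI[of _ 0]) auto
  next
    case (step k y w)
    then obtain z where z: "z \<in> ?W" "w - (A z - d *s z) \<in> gen_eigenspace A d" by blast
    from step obtain c where c: "y \<in> gen_eigenspace A c" by blast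
    show ?case
    proof (cases "c = d")
      case True
      have "k *s y + (w - (A z - d *s z)) \<in> gen_eigenspace A d"
        using c z True subspace_gen_eigenspace[OF A] by (simp add: subspace_add subspace_scale)
      then show ?thesis using z(1) by (auto simp: algebra_simps)
    next
      case False
      then obtain u where u: "u \<in> gen_eigenspace A c" "A u - d *s u = y"
        using gen_eigenspace_shift_surj[OF A c] by blast
      have "A (z + k *s u) - d *s (z + k *s u) = (A z - d *s z) + k *s (A u - d *s u)"
        using A by (simp add: endo.linear_add endo.linear_scale algebra_simps)
      then have "k *s y + w - (A (z + k *s u) - d *s (z + k *s u)) = w - (A z - d *s z)"
        by (simp add: u(2))
      moreover have "z + k *s u \<in> ?W"
        using z(1) u(1) by (intro span_add[OF z(1)] span_scale span_base) auto
      ultimately show ?thesis using z(2) by metis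
    qed
  qed
  ultimately obtain z where z: "z \<in> ?W"
    "A x - d *s x - (A z - d *s z) \<in> gen_eigenspace A d" by blast
  then have "A (x - z) - d *s (x - z) \<in> gen_eigenspace A d"
    using A by (simp add: endo.linear_diff algebra_simps)
  then have "x - z \<in> ?W" by (intro span_base) (blast intro: gen_eigenspace_shiftD)
  from span_add[OF this z(1)] show ?case by simp
qed

text \<open>A basis drawn from the generalized eigenspaces diagonalizes \<open>D\<close> by
  construction; independence of the \<open>V\<^sub>c\<close> extends the scalar action from the
  basis to all of \<open>V\<^sub>c\<close>. The free choice of \<open>\<phi>\<close> provides both
  \<open>S\<close> and its inverse.\<close>

lemma ex_gen_eigenspace_scaling:
  assumes A: "endo A" and span: "span (\<Union>c. gen_eigenspace A c) = UNIV"
  shows "\<exists>D. diagonalizable_op scale D \<and> (\<forall>c. \<forall>x \<in> gen_eigenspace A c. D x = \<phi> c *s x)"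
proof -
  obtain B where B: "B \<subseteq> (\<Union>c. gen_eigenspace A c)" "independent B"
    "(\<Union>c. gen_eigenspace A c) \<subseteq> span B"
    using maximal_independent_subset by blast
  have spanB: "span B = UNIV" using B(3) span by (metis span_eq span_mono span_span top.extremum_uniqueI)
  obtain ev where ev: "\<And>b. b \<in> B \<Longrightarrow> b \<in> gen_eigenspace A (ev b)"
    using B(1) by (metis UN_iff subsetD)
  define D where "D = endo.construct B (\<lambda>b. \<phi> (ev b) *s b)"
  have D: "endo D" "\<And>b. b \<in> B \<Longrightarrow> D b = \<phi> (ev b) *s b"
    unfolding D_def by (simp_all add: endo.linear_construct endo.construct_basis B(2))
  have "D x = \<phi> c *s x" if x: "x \<in> gen_eigenspace A c" for c x
  proof -
    have "x \<in> span B" using spanB by simp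
    then obtain t r where t: "finite t" "t \<subseteq> B" "x = (\<Sum>b\<in>t. r b *s b)"
      unfolding span_explicit by blast
    define w where "w e = (\<Sum>b | b \<in> t \<and> ev b = e. r b *s b)" for e
    \<comment> \<open>The expansion of \<open>x\<close> need not contain a basis vector labelled
      \<open>c\<close>, hence the insertion.\<close>
    define F where "F = insert c (ev ` t)"
    \<comment> \<open>These vectors sum to zero, so independence gives \<open>w c = x\<close> and
      \<open>w e = 0\<close> for the other labels.\<close>
    define v where "v e = (if e = c then w e - x else w e)" for e
    have F: "finite F" "c \<in> F" unfolding F_def using t(1) by auto
    have w: "w e \<in> gen_eigenspace A e" for e
      unfolding w_def using t(2) ev subspace_scale[OF subspace_gen_eigenspace[OF A]]
      by (intro subspace_sum[OF subspace_gen_eigenspace[OF A]]) auto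
    have "ev ` t \<subseteq> F" unfolding F_def by blast
    from sum.group[OF t(1) F(1) this, of "\<lambda>b. r b *s b"]
    have sum_w: "x = sum w F" unfolding t(3) w_def by simp
    have "sum v F = sum w F - x"
      using F unfolding v_def by (simp add: sum.remove[of F c])
    then have sum_v: "sum v F = 0" using sum_w by simp
    have v_mem: "v e \<in> gen_eigenspace A e" for e
      unfolding v_def using w x subspace_diff[OF subspace_gen_eigenspace[OF A]] by simp
    have v0: "v e = 0" if "e \<in> F" for e
      using A F(1) v_mem sum_v that by (rule gen_eigenspace_independent)
    have Dw: "D (w e) = \<phi> e *s w e" for e
    proof -
      have "D (w e) = (\<Sum>b | b \<in> t \<and> ev b = e. r b *s D b)"
        unfolding w_def using D(1) by (simp add: endo.linear_sum endo.linear_scale)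
      also have "\<dots> = (\<Sum>b | b \<in> t \<and> ev b = e. \<phi> e *s r b *s b)"
        using D(2) t(2) by (intro sum.cong) (auto simp: scale_left_commute)
      also have "\<dots> = \<phi> e *s w e"
        unfolding w_def by (simp only: scale_sum_right)
      finally show ?thesis .
    qed
    have "D x = (\<Sum>e\<in>F. D (w e))"
      by (subst sum_w) (rule endo.linear_sum[OF D(1)])
    also have "\<dots> = (\<Sum>e\<in>F. \<phi> c *s w e)"
    proof (rule sum.cong[OF refl])
      fix e assume "e \<in> F"
      then show "D (w e) = \<phi> c *s w e"
        unfolding Dw using v0[of e] by (cases "e = c") (simp_all add: v_def)
    qed
    also have "\<dots> = \<phi> c *s x"
      by (subst sum_w) (simp only: scale_sum_right)
    finally show ?thesis .
  qed
  moreover have "diagonalizable_op scale D"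
    unfolding diagonalizable_op_def using D B(2) spanB by blast
  ultimately show ?thesis by blast
qed

end

section \<open>Annihilating polynomials and nilpotency in finite dimension\<close>

locale finite_dimensional_endo =
  vector_space_endo scale + finite_dimensional_vector_space scale Basis
  for scale :: "'f::field \<Rightarrow> 'a::ab_group_add \<Rightarrow> 'a"  (infixr \<open>*s\<close> 75) and Basis
begin

text \<open>The orbit of \<open>x\<close> under \<open>A\<close> is either an infinite set, hence
  linearly dependent, or repeats a vector.\<close>

lemma ex_annihilating_poly:
  assumes A: "endo A"
  shows "\<exists>p. p \<noteq> 0 \<and> poly_op A p x = 0"
proof (cases "inj (\<lambda>i. (A ^^ i) x)")
  case True
  define S where "S = range (\<lambda>i. (A ^^ i) x)"
  have "infinite S" unfolding S_def using True finite_imageD by blast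
  then have "dependent S" using finiteI_independent by blast
  then obtain t u where t: "finite t" "t \<subseteq> S" "(\<Sum>v\<in>t. u v *s v) = 0" "\<exists>v\<in>t. u v \<noteq> 0"
    unfolding dependent_explicit by blast
  \<comment> \<open>By injectivity each vector of the relation has a unique exponent, so the
    relation can be read as a polynomial.\<close>
  define I where "I = {i. (A ^^ i) x \<in> t}"
  have bij: "bij_betw (\<lambda>i. (A ^^ i) x) I t"
    using True t(2) unfolding I_def S_def bij_betw_def by (auto simp: inj_on_def)
  then have fI: "finite I" using t(1) bij_betw_finite by blast
  define p where "p = (\<Sum>i\<in>I. monom (u ((A ^^ i) x)) i)"
  have cp: "coeff p i = (if i \<in> I then u ((A ^^ i) x) else 0)" for i
    unfolding p_def using fI by (simp add: coeff_sum sum.If_cases)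
  have "p \<noteq> 0"
  proof -
    obtain i where "i \<in> I" "u ((A ^^ i) x) \<noteq> 0"
      using t(4) bij unfolding bij_betw_def by blast
    then show ?thesis using cp[of i] by auto
  qed
  moreover have "poly_op A p x = 0"
  proof -
    have n: "degree p \<le> Max (insert (degree p) I)" "I \<subseteq> {..Max (insert (degree p) I)}"
      using fI by auto
    have "poly_op A p x = (\<Sum>i\<in>I. coeff p i *s (A ^^ i) x)"
      unfolding poly_op_eq[OF n(1)] using n(2) cp by (intro sum.mono_neutral_right) auto
    also have "\<dots> = (\<Sum>i\<in>I. u ((A ^^ i) x) *s (A ^^ i) x)"
      using cp by (intro sum.cong) auto
    also have "\<dots> = (\<Sum>v\<in>t. u v *s v)"
      using sum.reindex_bij_betw[OF bij] .
    finally show ?thesis using t(3) by simp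
  qed
  ultimately show ?thesis by blast
next
  case False
  \<comment> \<open>A repetition in the orbit gives the annihilator
    \<open>X^i - X^j\<close>.\<close>
  then obtain i j where ij: "i \<noteq> j" "(A ^^ i) x = (A ^^ j) x" by (auto simp: inj_def)
  have *: "poly_op A (monom c i) x = c *s (A ^^ i) x" for c i
    by (simp add: poly_op_eq[OF degree_monom_le] sum.If_cases if_distrib[of "\<lambda>a. scale a _"])
  have "poly_op A (monom 1 i + monom (-1) j) x = 0"
    using ij(2) by (simp add: poly_op_add *)
  moreover have "coeff (monom 1 i + monom (-1) j :: 'f poly) i \<noteq> 0" using ij(1) by simp
  then have "monom 1 i + monom (-1) j \<noteq> (0 :: 'f poly)" by (metis coeff_0)
  ultimately show ?thesis by blast
qed

lemma span_gen_eigenspaces: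
  assumes "endo A" and "\<And>p :: 'f poly. degree p > 0 \<Longrightarrow> \<exists>z. poly p z = 0"
  shows "span (\<Union>c. gen_eigenspace A c) = UNIV"
  using in_span_gen_eigenspaces[OF assms] ex_annihilating_poly[OF assms(1)] by blast

text \<open>The vectors killed by some power form a subspace, hence everything; the maximum over the
  finite basis is a uniform exponent.\<close>

lemma nilpotent_op_if_locally_nilpotent:
  assumes A: "endo A" and "span S = UNIV" "\<And>x. x \<in> S \<Longrightarrow> \<exists>n. (A ^^ n) x = 0"
  shows "nilpotent_op scale A"
proof -
  have "span S \<subseteq> {x. \<exists>n. (A ^^ n) x = 0}"
    using assms(3) subspace_funpow_kernel[OF A] by (intro span_minimal) auto
  then have "\<forall>x. \<exists>n. (A ^^ n) x = 0" using assms(2) by blast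
  then obtain n where n: "\<And>x. (A ^^ n x) x = 0" by metis
  define N where "N = Max (insert 0 (n ` Basis))"
  have "(A ^^ N) b = 0" if "b \<in> Basis" for b
  proof (rule funpow_eq_0_mono[OF A n])
    show "n b \<le> N" unfolding N_def using finite_Basis that by simp
  qed
  moreover have "endo (\<lambda>x. 0)" by (simp add: Vector_Spaces.linear_iff vector_space_axioms)
  ultimately have "A ^^ N = (\<lambda>x. 0)"
    using endo_eq_on[OF endo_funpow[OF A] _ span_Basis] by blast
  then show ?thesis unfolding nilpotent_op_def using A by metis
qed

end

subsection \<open>Power series in nilpotent operators\<close>

context vector_space_endo
begin

text \<open>Summing over the nonzero terms, as in \<open>exp_op\<close>, makes \<open>exp_op\<close>
  literally the case of \<open>fps_exp 1\<close>.\<close>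

definition fps_op :: "'f fps \<Rightarrow> ('a \<Rightarrow> 'a) \<Rightarrow> 'a \<Rightarrow> 'a" where
  "fps_op f T x = (\<Sum>k | (T ^^ k) x \<noteq> 0. fps_nth f k *s (T ^^ k) x)"

lemma fps_op_eq:
  assumes T: "endo T" and n: "(T ^^ n) x = 0"
  shows "fps_op f T x = (\<Sum>k<n. fps_nth f k *s (T ^^ k) x)"
proof -
  have "{k. (T ^^ k) x \<noteq> 0} \<subseteq> {..<n}"
    using funpow_eq_0_mono[OF T n] by (auto simp: not_less[symmetric])
  then show ?thesis
    unfolding fps_op_def by (intro sum.mono_neutral_left) auto
qed

lemma endo_fps_op:
  assumes "nilpotent_op scale T"
  shows "endo (fps_op f T)"
proof -
  obtain n where T: "endo T" and n: "\<And>x. (T ^^ n) x = 0"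
    using assms unfolding nilpotent_op_def by blast
  have "fps_op f T = (\<lambda>x. \<Sum>k<n. fps_nth f k *s (T ^^ k) x)"
    using fps_op_eq[OF T n] by blast
  moreover have "endo (\<lambda>x. \<Sum>k<n. fps_nth f k *s (T ^^ k) x)"
    by (intro endo.linear_compose_sum ballI endo.linear_compose_scale_right endo_funpow T)
  ultimately show ?thesis by simp
qed

lemma fps_op_add:
  assumes "nilpotent_op scale T"
  shows "fps_op (f + g) T x = fps_op f T x + fps_op g T x"
proof -
  obtain n where T: "endo T" and n: "\<And>x. (T ^^ n) x = 0"
    using assms unfolding nilpotent_op_def by blast
  show ?thesis by (simp add: fps_op_eq[OF T n] scale_left_distrib sum.distrib)
qed

lemma fps_op_1:
  assumes "nilpotent_op scale T"
  shows "fps_op 1 T x = x"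
proof -
  obtain n where T: "endo T" and n: "\<And>x. (T ^^ n) x = 0"
    using assms unfolding nilpotent_op_def by blast
  \<comment> \<open>The successor keeps the constant term in range even for
    \<open>n = 0\<close>.\<close>
  have "(T ^^ Suc n) x = 0" by (rule funpow_eq_0_mono[OF T n]) simp
  from fps_op_eq[OF T this] show ?thesis
    by (simp add: sum.lessThan_Suc_shift del: sum.lessThan_Suc funpow.simps)
qed

lemma fps_op_X:
  assumes "nilpotent_op scale T"
  shows "fps_op fps_X T x = T x"
proof -
  obtain n where T: "endo T" and n: "\<And>x. (T ^^ n) x = 0"
    using assms unfolding nilpotent_op_def by blast
  have "(T ^^ Suc (Suc n)) x = 0" by (rule funpow_eq_0_mono[OF T n]) simp
  from fps_op_eq[OF T this] show ?thesis
    by (simp add: sum.lessThan_Suc_shift fps_X_def del: sum.lessThan_Suc funpow.simps) simp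
qed

text \<open>The coefficients of \<open>f * g\<close> are Cauchy sums over a triangle, whereas
  composing the operators gives a sum over a square.\<close>

lemma fps_op_mult:
  assumes "nilpotent_op scale T"
  shows "fps_op (f * g) T x = fps_op f T (fps_op g T x)"
proof -
  obtain n where T: "endo T" and n: "\<And>x. (T ^^ n) x = 0"
    using assms unfolding nilpotent_op_def by blast
  let ?h = "\<lambda>i j. (fps_nth f i * fps_nth g j) *s (T ^^ (i + j)) x"
  have less: "k < n" if "(T ^^ k) y \<noteq> 0" for k y
    using funpow_eq_0_mono[OF T n, of k y] that by (metis not_less)
  have "fps_op (f * g) T x = (\<Sum>k<n. \<Sum>i\<le>k. ?h i (k - i))"
    by (simp add: fps_op_eq[OF T n] fps_mult_nth scale_sum_left atLeast0AtMost)
  also have "\<dots> = (\<Sum>(i, j) | i + j < n. ?h i j)"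
    by (rule sum.triangle_reindex[symmetric])
  \<comment> \<open>Terms of the square outside the triangle contain \<open>T ^^ (i + j)\<close>
    with \<open>i + j \<ge> n\<close> and vanish.\<close>
  also have "\<dots> = (\<Sum>(i, j) \<in> {..<n} \<times> {..<n}. ?h i j)"
    by (rule sum.mono_neutral_left) (auto dest: less)
  also have "\<dots> = (\<Sum>i<n. \<Sum>j<n. ?h i j)"
    by (simp add: sum.cartesian_product)
  also have "\<dots> = fps_op f T (fps_op g T x)"
    by (simp add: fps_op_eq[OF T n] endo.linear_sum[OF endo_funpow[OF T]]
        endo.linear_scale[OF endo_funpow[OF T]] scale_sum_right funpow_add)
  finally show ?thesis .
qed

lemma fps_op_power:
  assumes "nilpotent_op scale T"
  shows "fps_op (f ^ k) T x = (fps_op f T ^^ k) x"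
  by (induction k) (simp_all add: fps_op_1 fps_op_mult assms)

text \<open>Without a constant term, \<open>g ^ k\<close> starts at order at least
  \<open>k \<ge> n\<close>, where the powers of \<open>T\<close> are already zero.\<close>

lemma funpow_fps_op_eq_0:
  assumes T: "endo T" and n: "\<And>x. (T ^^ n) x = 0" and "fps_nth g 0 = 0" and "n \<le> k"
  shows "(fps_op g T ^^ k) x = 0"
proof -
  have nil: "nilpotent_op scale T" unfolding nilpotent_op_def using T n by blast
  have "(fps_op g T ^^ k) x = (\<Sum>j<n. fps_nth (g ^ k) j *s (T ^^ j) x)"
    unfolding fps_op_power[OF nil, symmetric] by (rule fps_op_eq[OF T n])
  also have "\<dots> = 0"
    using startsby_zero_power_prefix[OF assms(3)] assms(4) by simp
  finally show ?thesis .
qed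

lemma nilpotent_fps_op:
  assumes "nilpotent_op scale T" "fps_nth g 0 = 0"
  shows "nilpotent_op scale (fps_op g T)"
proof -
  obtain n where T: "endo T" and n: "\<And>x. (T ^^ n) x = 0"
    using assms(1) unfolding nilpotent_op_def by blast
  show ?thesis
    unfolding nilpotent_op_def
    using endo_fps_op[OF assms(1)] funpow_fps_op_eq_0[OF T n assms(2) order.refl] by blast
qed

text \<open>This turns the inverse relation between the exponential and logarithm series into one
  between operators.\<close>

lemma fps_op_compose:
  assumes "nilpotent_op scale T" "fps_nth g 0 = 0"
  shows "fps_op (f oo g) T x = fps_op f (fps_op g T) x"
proof -
  obtain n where T: "endo T" and n: "\<And>x. (T ^^ n) x = 0"
    using assms(1) unfolding nilpotent_op_def by blast
  \<comment> \<open>As \<open>g ^ i\<close> has order at least \<open>i\<close>, the bound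
    \<open>i \<le> j\<close> can be relaxed to \<open>i < n\<close>, uniformly in
    \<open>j\<close>.\<close>
  have comp: "fps_nth (f oo g) j = (\<Sum>i<n. fps_nth f i * fps_nth (g ^ i) j)" if "j < n" for j
    unfolding fps_compose_nth using that startsby_zero_power_prefix[OF assms(2)]
    by (intro sum.mono_neutral_left) auto
  have "fps_op (f oo g) T x = (\<Sum>j<n. \<Sum>i<n. (fps_nth f i * fps_nth (g ^ i) j) *s (T ^^ j) x)"
    by (simp add: fps_op_eq[OF T n] comp scale_sum_left)
  also have "\<dots> = (\<Sum>i<n. fps_nth f i *s (\<Sum>j<n. fps_nth (g ^ i) j *s (T ^^ j) x))"
    by (subst sum.swap) (simp add: scale_sum_right)
  also have "\<dots> = (\<Sum>i<n. fps_nth f i *s (fps_op g T ^^ i) x)"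
    by (simp add: fps_op_power[OF assms(1), symmetric] fps_op_eq[OF T n])
  also have "\<dots> = fps_op f (fps_op g T) x"
    by (rule fps_op_eq[symmetric])
      (simp_all add: endo_fps_op assms(1) funpow_fps_op_eq_0[OF T n assms(2)])
  finally show ?thesis .
qed

lemma fps_op_commute:
  assumes "nilpotent_op scale T" "endo S" "\<And>x. S (T x) = T (S x)"
  shows "S (fps_op f T x) = fps_op f T (S x)"
proof -
  obtain n where T: "endo T" and n: "\<And>x. (T ^^ n) x = 0"
    using assms(1) unfolding nilpotent_op_def by blast
  have "S ((T ^^ k) x) = (T ^^ k) (S x)" for k
    by (induction k) (simp_all add: assms(3))
  then show ?thesis
    by (simp add: fps_op_eq[OF T n] endo.linear_sum endo.linear_scale assms(2))
qed

text \<open>Each coordinate in a basis is a scalar polynomial with infinitely many roots.\<close>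

lemma vanishing_polynomial_coeffs:
  assumes "infinite Z" and "\<And>c. c \<in> Z \<Longrightarrow> (\<Sum>k<n. c ^ k *s d k) = 0" and "k < n"
  shows "d k = 0"
proof -
  obtain B where "B \<subseteq> UNIV" and B: "independent B" "UNIV \<subseteq> span B"
    by (rule maximal_independent_subset)
  then have spanB: "span B = UNIV" by blast
  have "representation B (d k) b = 0" for b
  proof -
    define p where "p = (\<Sum>k<n. monom (representation B (d k) b) k)"
    have "poly p c = 0" if "c \<in> Z" for c
    proof -
      have "poly p c = representation B (\<Sum>k<n. c ^ k *s d k) b"
        unfolding p_def using B(1) spanB
        by (simp add: poly_sum poly_monom representation_sum representation_scale mult.commute)
      then show ?thesis using assms(2)[OF that] by (simp add: representation_zero)
    qed
    then have "p = 0"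
      using poly_roots_finite[of p] assms(1) finite_subset[of Z "{c. poly p c = 0}"] by blast
    moreover have "coeff p k = representation B (d k) b"
      unfolding p_def using assms(3) by (simp add: coeff_sum)
    ultimately show ?thesis by simp
  qed
  then show ?thesis
    using sum_nonzero_representation_eq[OF B(1), of "d k"] spanB by simp
qed

text \<open>\<open>(A - c d) [x, y] = [(A - c) x, A y] + c [x, (A - d) y]\<close>: the outer
  induction handles the first summand, the inner one the second.\<close>

lemma gen_eigenspace_bracket:
  assumes A: "endo A" and bl: "\<And>y. endo (\<lambda>x. bracket x y)" and br: "\<And>x. endo (bracket x)"
    and mult: "\<And>x y. A (bracket x y) = bracket (A x) (A y)"
    and x: "x \<in> gen_eigenspace A c" and y: "y \<in> gen_eigenspace A d"
  shows "bracket x y \<in> gen_eigenspace A (c * d)"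
proof -
  \<comment> \<open>All \<open>y\<close> are covered at once because the outer hypothesis is applied
    to \<open>A y\<close>.\<close>
  have "\<forall>y \<in> gen_eigenspace A d. bracket x y \<in> gen_eigenspace A (c * d)"
    using A x
  proof (induction rule: gen_eigenspace_induct)
    case zero
    show ?case
      using endo.linear_0[OF bl] subspace_0[OF subspace_gen_eigenspace[OF A]] by simp
  next
    case (step x)
    show ?case
    proof
      fix y assume "y \<in> gen_eigenspace A d"
      with A show "bracket x y \<in> gen_eigenspace A (c * d)"
      proof (induction rule: gen_eigenspace_induct)
        case zero
        show ?case
          using endo.linear_0[OF br] subspace_0[OF subspace_gen_eigenspace[OF A]] by simp
      next
        case (step y)
        have "A (bracket x y) - (c * d) *s bracket x y =
          bracket (A x - c *s x) (A y) + c *s bracket x (A y - d *s y)"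
          by (simp add: mult endo.linear_diff[OF bl] endo.linear_diff[OF br]
              endo.linear_scale[OF bl] endo.linear_scale[OF br] scale_right_diff_distrib)
        also have "\<dots> \<in> gen_eigenspace A (c * d)"
          using \<open>\<forall>y \<in> gen_eigenspace A d. bracket (A x - c *s x) y \<in> gen_eigenspace A (c * d)\<close>
            gen_eigenspace_image[OF A step(1)] step(2)
          by (intro subspace_add subspace_scale subspace_gen_eigenspace A) auto
        finally show ?case by (rule gen_eigenspace_shiftD)
      qed
    qed
  qed
  with y show ?thesis by blast
qed

end

section \<open>Exponential and logarithm in characteristic 0\<close>

locale vector_space_endo_char_0 = vector_space_endo scale
  for scale :: "'f::field_char_0 \<Rightarrow> 'a::ab_group_add \<Rightarrow> 'a"  (infixr \<open>*s\<close> 75)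
begin

lemma exp_op_eq_fps_op: "exp_op scale = fps_op (fps_exp 1)"
  by (intro ext) (simp add: exp_op_def fps_op_def)

text \<open>In characteristic 0 the natural numbers \<open>m\<close> are infinitely many scalars at
  which \<open>exp (m T)\<close> respects the bracket, enough to compare coefficients of
  \<open>m\<close>.\<close>

lemma derivation_if_exp_multiplicative:
  assumes nil: "nilpotent_op scale T"
    and bl: "\<And>y. endo (\<lambda>x. bracket x y)" and br: "\<And>x. endo (bracket x)"
    and mult: "\<And>x y. exp_op scale T (bracket x y) = bracket (exp_op scale T x) (exp_op scale T y)"
  shows "T (bracket x y) = bracket (T x) y + bracket x (T y)"
proof -
  obtain n where T: "endo T" and n: "\<And>x. (T ^^ n) x = 0"
    using nil unfolding nilpotent_op_def by blast
  let ?e = "\<lambda>k x. (1 / fact k) *s (T ^^ k) x"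
  let ?h = "\<lambda>i j. bracket (?e i x) (?e j y)"
  \<comment> \<open>All pairs \<open>i, j < n\<close> satisfy \<open>i + j < N\<close>, and the
    added 2 ensures \<open>1 < N\<close> even for \<open>n = 0\<close>.\<close>
  define N where "N = 2 * n + 2"
  \<comment> \<open>The difference of the coefficients of \<open>m^k\<close> on the two
    sides.\<close>
  define d where "d k = ?e k (bracket x y) - (\<Sum>i\<le>k. ?h i (k - i))" for k
  have zero: "(T ^^ k) z = 0" if "k \<ge> n" for k z by (rule funpow_eq_0_mono[OF T n that])
  have h_zero: "?h i j = 0" if "n \<le> i \<or> n \<le> j" for i j
    using that by (auto simp: zero endo.linear_0[OF bl] endo.linear_0[OF br])
  have exp_N: "fps_op (fps_exp c) T z = (\<Sum>k<N. c ^ k *s ?e k z)" for c z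
    using fps_op_eq[OF T zero[of N z], of "fps_exp c"] unfolding N_def by simp
  have exp_n: "fps_op (fps_exp c) T z = (\<Sum>k<n. c ^ k *s ?e k z)" for c z
    using fps_op_eq[OF T n] by simp
  have mult_power: "fps_op (fps_exp (of_nat m)) T (bracket u v) =
      bracket (fps_op (fps_exp (of_nat m)) T u) (fps_op (fps_exp (of_nat m)) T v)" for m u v
  proof -
    have "fps_exp (of_nat m) = fps_exp (1 :: 'f) ^ m"
      by (simp add: fps_exp_power_mult)
    moreover have "(exp_op scale T ^^ m) (bracket u v) =
        bracket ((exp_op scale T ^^ m) u) ((exp_op scale T ^^ m) v)"
      by (induction m) (simp_all add: mult)
    ultimately show ?thesis
      by (simp add: fps_op_power[OF nil] exp_op_eq_fps_op)
  qed
  have "(\<Sum>k<N. of_nat m ^ k *s d k) = 0" for m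
  proof -
    let ?c = "of_nat m :: 'f"
    have "fps_op (fps_exp ?c) T (bracket x y) =
        bracket (\<Sum>i<n. ?c ^ i *s ?e i x) (\<Sum>j<n. ?c ^ j *s ?e j y)"
      unfolding mult_power unfolding exp_n ..
    also have "\<dots> = (\<Sum>j<n. \<Sum>i<n. ?c ^ (i + j) *s ?h i j)"
      by (simp add: endo.linear_sum[OF bl] endo.linear_sum[OF br] endo.linear_scale[OF bl]
          endo.linear_scale[OF br] scale_sum_right power_add mult_ac)
    also have "\<dots> = (\<Sum>i<n. \<Sum>j<n. ?c ^ (i + j) *s ?h i j)"
      by (rule sum.swap)
    also have "\<dots> = (\<Sum>(i, j) \<in> {..<n} \<times> {..<n}. ?c ^ (i + j) *s ?h i j)"
      by (simp add: sum.cartesian_product)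
    \<comment> \<open>The added terms have \<open>i \<ge> n\<close> or \<open>j \<ge> n\<close> and
      vanish.\<close>
    also have "\<dots> = (\<Sum>(i, j) | i + j < N. ?c ^ (i + j) *s ?h i j)"
    proof (rule sum.mono_neutral_left)
      show "finite {(i, j). i + j < N}"
        by (rule finite_subset[of _ "{..<N} \<times> {..<N}"]) auto
      show "\<forall>p \<in> {(i, j). i + j < N} - {..<n} \<times> {..<n}.
          (case p of (i, j) \<Rightarrow> ?c ^ (i + j) *s ?h i j) = 0"
      proof
        fix p assume p: "p \<in> {(i, j). i + j < N} - {..<n} \<times> {..<n}"
        obtain i j where ij: "p = (i, j)" by (cases p)
        have "?h i j = 0" using p unfolding ij by (intro h_zero) auto
        then show "(case p of (i, j) \<Rightarrow> ?c ^ (i + j) *s ?h i j) = 0"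
          by (simp only: ij prod.case scale_zero_right)
      qed
    qed (auto simp: N_def)
    also have "\<dots> = (\<Sum>k<N. \<Sum>i\<le>k. ?c ^ (i + (k - i)) *s ?h i (k - i))"
      by (rule sum.triangle_reindex)
    also have "\<dots> = (\<Sum>k<N. ?c ^ k *s (\<Sum>i\<le>k. ?h i (k - i)))"
      by (simp add: scale_sum_right)
    finally show ?thesis
      unfolding d_def exp_N by (simp add: scale_right_diff_distrib sum_subtractf)
  qed
  then have vanish: "(\<Sum>k<N. c ^ k *s d k) = 0" if "c \<in> range of_nat" for c
    using that by blast
  have infinite: "infinite (range of_nat :: 'f set)"
    by (intro range_inj_infinite inj_of_nat)
  have "1 < N" by (simp add: N_def)
  from vanishing_polynomial_coeffs[OF infinite vanish this] have "d 1 = 0" .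
  \<comment> \<open>The two summands \<open>i = 0\<close> and \<open>i = 1\<close> of
    \<open>d 1\<close> are the right-hand side of the Leibniz rule.\<close>
  then show ?thesis by (simp add: d_def)
qed

text \<open>The series \<open>fps_inv (fps_exp 1 - 1)\<close> is the expansion of \<open>ln (1 + X)\<close>.\<close>

lemma exp_op_minus_id:
  assumes "nilpotent_op scale T"
  shows "fps_op (fps_exp 1 - 1) T x = exp_op scale T x - x"
  using fps_op_add[OF assms, of "fps_exp 1 - 1" 1 x] fps_op_1[OF assms, of x]
  by (simp add: exp_op_eq_fps_op)

text \<open>The logarithm series as a left inverse: for uniqueness, \<open>T\<close> is recovered
  from \<open>exp T\<close>.\<close>

lemma log_exp_op:
  assumes "nilpotent_op scale T"
  shows "fps_op (fps_inv (fps_exp 1 - 1)) (\<lambda>x. exp_op scale T x - x) = T"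
proof
  fix x
  have "fps_inv (fps_exp 1 - 1 :: 'f fps) oo (fps_exp 1 - 1) = fps_X"
    by (rule fps_inv) simp_all
  then have "T x = fps_op (fps_inv (fps_exp 1 - 1)) (fps_op (fps_exp 1 - 1) T) x"
    by (simp add: fps_op_compose[OF assms, symmetric] fps_op_X[OF assms])
  also have "fps_op (fps_exp 1 - 1) T = (\<lambda>x. exp_op scale T x - x)"
    by (rule ext) (rule exp_op_minus_id[OF assms])
  finally show "fps_op (fps_inv (fps_exp 1 - 1)) (\<lambda>x. exp_op scale T x - x) x = T x" ..
qed

lemma nilpotent_log:
  assumes "nilpotent_op scale N"
  shows "nilpotent_op scale (fps_op (fps_inv (fps_exp 1 - 1)) N)"
  using assms by (rule nilpotent_fps_op) (simp add: fps_inv_def)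

text \<open>The logarithm series as a right inverse: for existence, \<open>1 + N\<close> is an
  exponential.\<close>

lemma exp_log_op:
  assumes "nilpotent_op scale N"
  shows "exp_op scale (fps_op (fps_inv (fps_exp 1 - 1)) N) x = x + N x"
proof -
  let ?T = "fps_op (fps_inv (fps_exp 1 - 1)) N"
  have "(fps_exp 1 - 1 :: 'f fps) oo fps_inv (fps_exp 1 - 1) = fps_X"
    by (rule fps_inv_right) simp_all
  moreover have "fps_nth (fps_inv (fps_exp 1 - 1 :: 'f fps)) 0 = 0"
    by (simp add: fps_inv_def)
  ultimately have "fps_op (fps_exp 1 - 1) ?T x = N x"
    by (simp add: fps_op_compose[OF assms, symmetric] fps_op_X[OF assms])
  then show ?thesis
    unfolding exp_op_minus_id[OF nilpotent_log[OF assms]] by (simp add: algebra_simps)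
qed

text \<open>\<open>N = exp T - 1\<close> commutes with \<open>S\<close> and so preserves its
  eigenspace for \<open>c\<close>, on which \<open>A - c\<close> equals \<open>c N\<close> and is
  nilpotent.\<close>

lemma eigenvector_in_gen_eigenspace:
  assumes T: "nilpotent_op scale T" and S: "endo S" "\<And>x. S (T x) = T (S x)"
    and A: "\<And>x. A x = S (exp_op scale T x)" and x: "S x = c *s x"
  shows "x \<in> gen_eigenspace A c"
proof -
  define N where "N = fps_op (fps_exp 1 - 1) T"
  have N: "nilpotent_op scale N" unfolding N_def by (rule nilpotent_fps_op[OF T]) simp
  then obtain n where "endo N" and n: "(N ^^ n) x = 0" unfolding nilpotent_op_def by blast
  have SN: "S (N y) = N (S y)" for y
    unfolding N_def by (rule fps_op_commute[OF T S])
  have A': "A y - c *s y = c *s N y" if "S y = c *s y" for y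
  proof -
    have "exp_op scale T y = y + N y"
      unfolding N_def exp_op_minus_id[OF T] by simp
    then have "A y = S y + S (N y)" by (simp add: A endo.linear_add S(1))
    then show ?thesis
      by (simp add: SN that endo.linear_scale[OF \<open>endo N\<close>])
  qed
  \<comment> \<open>The second conjunct keeps the iterates in the eigenspace of \<open>S\<close>,
    where \<open>A'\<close> applies.\<close>
  have "(((\<lambda>y. A y - c *s y) ^^ k) x = (c ^ k) *s (N ^^ k) x) \<and> S ((N ^^ k) x) = c *s (N ^^ k) x" for k
  proof (induction k)
    case (Suc k)
    have "S (c ^ k *s (N ^^ k) x) = c *s c ^ k *s (N ^^ k) x"
      using Suc by (simp add: endo.linear_scale[OF S(1)] mult.commute)
    from A'[OF this] show ?case
      using Suc by (simp add: SN endo.linear_scale[OF \<open>endo N\<close>])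
  qed (simp add: x)
  from this[of n] have "((\<lambda>y. A y - c *s y) ^^ n) x = 0" by (simp add: n)
  then show ?thesis unfolding gen_eigenspace_def by blast
qed

end

section \<open>The multiplicative decomposition of an automorphism\<close>

theorem theorem3p7:
  fixes scale :: "complex \<Rightarrow> 'a::ab_group_add \<Rightarrow> 'a"
    and bracket :: "'a \<Rightarrow> 'a \<Rightarrow> 'a"
    and Basis :: "'a set"
    and A :: "'a \<Rightarrow> 'a"
  assumes "finite_dimensional_vector_space scale Basis"
    and "leibniz_algebra scale bracket"
    and "leibniz_automorphism scale bracket A"
  shows "\<exists>!(A\<^sub>0, T).
           leibniz_automorphism scale bracket A\<^sub>0 \<and> diagonalizable_op scale A\<^sub>0 \<and>
           leibniz_derivation scale bracket T \<and> nilpotent_op scale T \<and>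
           A = A\<^sub>0 \<circ> exp_op scale T \<and> A\<^sub>0 \<circ> T = T \<circ> A\<^sub>0"
proof -
  interpret V: finite_dimensional_vector_space scale Basis by fact
  interpret V: finite_dimensional_endo scale Basis by unfold_locales
  interpret V: vector_space_endo_char_0 scale by unfold_locales
  note bl = leibniz_algebra.linear_bracket_left[OF assms(2)]
  note br = leibniz_algebra.linear_bracket_right[OF assms(2)]
  have A: "V.endo A" and "bij A" and A_mult: "\<And>x y. A (bracket x y) = bracket (A x) (A y)"
    using assms(3) unfolding leibniz_automorphism_def by auto
  let ?V = "V.gen_eigenspace A"
  have "\<exists>z. poly p z = 0" if "degree p > 0" for p :: "complex poly"
    using that by (intro fundamental_theorem_of_algebra) (simp add: constant_degree)
  then have span: "V.span (\<Union>c. ?V c) = UNIV"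
    by (rule V.span_gen_eigenspaces[OF A])
  have eqI: "f x = g x"
    if "V.endo f" "V.endo g" "\<And>c x. x \<in> ?V c \<Longrightarrow> f x = g x" for f g x
    using V.endo_eq_on[OF that(1,2) span] that(3) by blast
  \<comment> \<open>Injectivity of \<open>A\<close> excludes the eigenvalue 0.\<close>
  have V_0: "x = 0" if "x \<in> ?V 0" for x
    using A that
  proof (induction rule: V.gen_eigenspace_induct)
    case (step x)
    then have "A x = A 0" using V.endo.linear_0[OF A] by simp
    with \<open>bij A\<close> show ?case by (metis bij_is_inj injD)
  qed simp

  obtain S where S_diag: "diagonalizable_op scale S" and S: "\<And>c x. x \<in> ?V c \<Longrightarrow> S x = scale c x"
    using V.ex_gen_eigenspace_scaling[OF A span, of "\<lambda>c. c"] by blast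
  \<comment> \<open>\<open>R\<close> will be the inverse of \<open>S\<close>; the default
    \<open>inverse 0 = 0\<close> is harmless since \<open>V\<^sub>0\<close> is zero.\<close>
  obtain R where R_diag: "diagonalizable_op scale R"
    and R: "\<And>c x. x \<in> ?V c \<Longrightarrow> R x = scale (inverse c) x"
    using V.ex_gen_eigenspace_scaling[OF A span, of inverse] by blast
  have endo_S: "V.endo S" and endo_R: "V.endo R"
    using S_diag R_diag unfolding diagonalizable_op_def by auto
  have comp: "V.endo (\<lambda>x. f (g x))" if "V.endo f" "V.endo g" for f g
    using Vector_Spaces.linear_compose[OF that(2,1)] by (simp add: o_def)
  have id: "V.endo (\<lambda>x. x)" by (simp add: Vector_Spaces.linear_iff V.vector_space_axioms)
  have RS: "R (S x) = x" for x
  proof (rule eqI[where f = "\<lambda>x. R (S x)" and g = "\<lambda>x. x"])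
    fix c x assume "x \<in> ?V c"
    then show "R (S x) = x"
      using V_0[of x]
      by (cases "c = 0") (simp_all add: S R V.endo.linear_scale[OF endo_R] V.endo.linear_0 endo_S endo_R)
  qed (rule comp[OF endo_R endo_S] id)+
  have SR: "S (R x) = x" for x
  proof (rule eqI[where f = "\<lambda>x. S (R x)" and g = "\<lambda>x. x"])
    fix c x assume "x \<in> ?V c"
    then show "S (R x) = x"
      using V_0[of x]
      by (cases "c = 0") (simp_all add: S R V.endo.linear_scale[OF endo_S] V.endo.linear_0 endo_S endo_R)
  qed (rule comp[OF endo_S endo_R] id)+
  have SA: "S (A x) = A (S x)" for x
  proof (rule eqI[where f = "\<lambda>x. S (A x)" and g = "\<lambda>x. A (S x)"])
    fix c x assume "x \<in> ?V c"
    then show "S (A x) = A (S x)"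
      using V.gen_eigenspace_image[OF A] by (simp add: S V.endo.linear_scale[OF A])
  qed (rule comp[OF endo_S A] comp[OF A endo_S])+
  \<comment> \<open>By linearity in each argument it suffices to take \<open>x\<close> in
    \<open>V\<^sub>c\<close> and \<open>y\<close> in \<open>V\<^sub>d\<close>, where both sides are
    \<open>c d [x, y]\<close>.\<close>
  have S_mult: "S (bracket x y) = bracket (S x) (S y)" for x y
  proof (rule eqI[where f = "\<lambda>y. S (bracket x y)" and g = "\<lambda>y. bracket (S x) (S y)"])
    fix d y assume y: "y \<in> ?V d"
    show "S (bracket x y) = bracket (S x) (S y)"
    proof (rule eqI[where f = "\<lambda>x. S (bracket x y)" and g = "\<lambda>x. bracket (S x) (S y)"])
      fix c x assume x: "x \<in> ?V c"
      have "bracket x y \<in> ?V (c * d)"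
        using A bl br A_mult x y by (rule V.gen_eigenspace_bracket)
      then show "S (bracket x y) = bracket (S x) (S y)"
        using x y by (simp add: S V.endo.linear_scale[OF bl] V.endo.linear_scale[OF br])
    next
      show "V.endo (\<lambda>x. S (bracket x y))"
        by (rule comp[OF endo_S bl])
      show "V.endo (\<lambda>x. bracket (S x) (S y))"
        by (rule comp[OF bl endo_S])
    qed
  next
    show "V.endo (\<lambda>y. S (bracket x y))"
      by (rule comp[OF endo_S br])
    show "V.endo (\<lambda>y. bracket (S x) (S y))"
      by (rule comp[OF br endo_S])
  qed
  have "bij S" using SR RS by (metis bij_iff)

  \<comment> \<open>The unipotent factor and its logarithm\<close>
  define N where "N x = R (A x) - x" for x
  have endo_N: "V.endo N"
    unfolding N_def by (rule V.endo.linear_compose_sub[OF comp[OF endo_R A] id])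
  have nil_N: "nilpotent_op scale N"
  proof (rule V.nilpotent_op_if_locally_nilpotent[OF endo_N span])
    fix x assume "x \<in> (\<Union>c. ?V c)"
    then obtain c where x: "x \<in> ?V c" by blast
    show "\<exists>n. (N ^^ n) x = 0"
    proof (cases "c = 0")
      case True
      with x V_0 have "(N ^^ 0) x = 0" by simp
      then show ?thesis ..
    next
      case False
      from A x show ?thesis
      proof (induction rule: V.gen_eigenspace_induct)
        case zero
        have "(N ^^ 0) 0 = 0" by simp
        then show ?case ..
      next
        case (step x)
        then obtain n where n: "(N ^^ n) (A x - scale c x) = 0" by blast
        \<comment> \<open>On \<open>V\<^sub>c\<close> the operator \<open>N\<close> is a multiple of
          \<open>A - c\<close>, so it inherits local nilpotency.\<close>
        have "N x = scale (inverse c) (A x - scale c x)"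
          using False V.gen_eigenspace_image[OF A step(1)]
          by (simp add: N_def R V.scale_right_diff_distrib)
        then have "(N ^^ Suc n) x = 0"
          using n by (simp add: funpow_Suc_right V.endo.linear_scale[OF V.endo_funpow[OF endo_N]]
              del: funpow.simps)
        then show ?case ..
      qed
    qed
  qed
  define T where "T = V.fps_op (fps_inv (fps_exp 1 - 1)) N"
  have nil_T: "nilpotent_op scale T"
    unfolding T_def by (rule V.nilpotent_log[OF nil_N])
  have exp_T: "exp_op scale T x = R (A x)" for x
    unfolding T_def V.exp_log_op[OF nil_N] by (simp add: N_def)
  have "S (N x) = N (S x)" for x
    unfolding N_def by (simp add: V.endo.linear_diff[OF endo_S] SR RS SA[symmetric])
  then have ST: "S (T x) = T (S x)" for x
    unfolding T_def by (rule V.fps_op_commute[OF nil_N endo_S])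
  \<comment> \<open>\<open>exp T\<close> is \<open>S\<^sup>-\<^sup>1 A\<close>, a composite of maps
    that respect the bracket.\<close>
  have "exp_op scale T (bracket x y) = bracket (exp_op scale T x) (exp_op scale T y)" for x y
    unfolding exp_T by (metis A_mult S_mult SR RS)
  then have T_deriv: "T (bracket x y) = bracket (T x) y + bracket x (T y)" for x y
    using nil_T bl br by (intro V.derivation_if_exp_multiplicative)

  show ?thesis
  proof (rule ex1I[of _ "(S, T)"], safe)
    show "leibniz_automorphism scale bracket S"
      unfolding leibniz_automorphism_def using endo_S \<open>bij S\<close> S_mult by blast
    show "diagonalizable_op scale S" by (rule S_diag)
    show "leibniz_derivation scale bracket T"
      unfolding leibniz_derivation_def using nil_T T_deriv unfolding nilpotent_op_def by blast
    show "nilpotent_op scale T" by (rule nil_T)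
    show "A = S \<circ> exp_op scale T" by (simp add: fun_eq_iff exp_T SR)
    show "S \<circ> T = T \<circ> S" by (simp add: fun_eq_iff ST)
  next

    \<comment> \<open>Uniqueness\<close>
    fix S' T'
    assume S': "leibniz_automorphism scale bracket S'" "diagonalizable_op scale S'"
      and T': "nilpotent_op scale T'"
      and A_eq: "A = S' \<circ> exp_op scale T'" and comm: "S' \<circ> T' = T' \<circ> S'"
    have endo_S': "V.endo S'" using S'(2) unfolding diagonalizable_op_def by blast
    obtain B where B: "V.span B = UNIV" "\<forall>b\<in>B. \<exists>c. S' b = scale c b"
      using S'(2) unfolding diagonalizable_op_def by (elim conjE exE) (rule that)
    \<comment> \<open>Eigenvectors of \<open>S'\<close> for \<open>c\<close> lie in
      \<open>V\<^sub>c\<close>, where \<open>S\<close> is also the scalar \<open>c\<close>, and they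
      span the space.\<close>
    have "S' b = S b" if b: "b \<in> B" for b
    proof -
      obtain c where c: "S' b = scale c b" using B(2) b by blast
      have "S' (T' x) = T' (S' x)" and "A x = S' (exp_op scale T' x)" for x
        using A_eq comm by (simp_all add: fun_eq_iff)
      from V.eigenvector_in_gen_eigenspace[OF T' endo_S' this c] have "b \<in> ?V c" .
      then show ?thesis using c S by simp
    qed
    then show "S' = S" by (rule V.endo_eq_on[OF endo_S' endo_S B(1)])
    \<comment> \<open>With equal diagonalizable factors, \<open>T'\<close> is the logarithm of the
      same unipotent operator.\<close>
    then have "exp_op scale T' x - x = N x" for x
      by (simp add: N_def A_eq RS)
    then show "T' = T"
      unfolding T_def using V.log_exp_op[OF T'] by simp
  qed
qed

end
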